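(* Let $\{P_{u,b}\}_{u\in\mathcal U,\,b\in B_u}$ be a measurement setting family on $\mathcal H=(\mathbb C^2)^{\otimes n}$, let $O=|\psi\rangle\langle\psi|$ with $|\psi\rangle\in\mathcal H$ a unit vector, and let $(q,\alpha)$ be an admissible pair for $O$. Let $X$ be the output of the corresponding one-shot estimator and let $$\mathsf M_{q,\alpha}=\sum_{u\in\mathcal U:\,q(u)>0}\ \sum_{b\in B_u}\frac{\alpha_{u,b}^2}{q(u)}P_{u,b}.$$ Then for every density operator $\rho$ on $\mathcal H$, $$\operatorname{Var}_\rho(X)=\operatorname{tr}(\rho\,\mathsf M_{q,\alpha})-\operatorname{tr}(\rho O)^2 .$$
   Context: $\mathcal H=(\mathbb C^2)^{\otimes n}$ is the $n$-qubit Hilbert space. A density operator (state) is an operator $\rho\succeq0$ on $\mathcal H$ with $\operatorname{tr}(\rho)=1$. A measurement setting family is a finite collection of operators $P_{u,b}\succeq 0$ on $\mathcal H$, indexed by settings $u\in\mathcal U$ and outcomes $b\in B_u$ (finite sets), such that $\sum_{b\in B_u}P_{u,b}=I$ for each $u\in\mathcal U$. An admissible pair $(q,\alpha)$ for $O$ consists of a probability distribution $q$ on $\mathcal U$ and real numbers $\alpha_{u,b}$ ($u\in\mathcal U$, $b\in B_u$) such that $\alpha_{u,b}=0$ for all $b\in B_u$ whenever $q(u)=0$, and $\sum_{u,b}\alpha_{u,b}P_{u,b}=O$ (the unbiasedness identity). The one-shot estimator corresponding to $(q,\alpha)$: when the state is $\rho$, sample $u$ from $q$, then obtain outcome $b\in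 B_u$ with probability $\operatorname{tr}(\rho P_{u,b})$, and output $X=\alpha_{u,b}/q(u)$. $\operatorname{Var}_\rho(X)$ is the variance of $X$ under this procedure. *)

theory Defs
  imports "HOL-Probability.Probability"
begin

text \<open>The \<open>n\<close>-qubit space \<open>(C^2)^{\<otimes>n}\<close> in computational-basis coordinates: basis vectors are indexed
  by bit strings \<open>'n \<Rightarrow> bool\<close>, where \<open>n = CARD('n)\<close>. The norm of \<^typ>\<open>complex ^ ('n::finite \<Rightarrow> bool)\<close>
  provided by the library is the Hilbert space norm.\<close>

type_synonym 'n qvec = "complex ^ ('n \<Rightarrow> bool)"
type_synonym 'n qop = "complex ^ ('n \<Rightarrow> bool) ^ ('n \<Rightarrow> bool)"

definition cdot :: "('n::finite) qvec \<Rightarrow> 'n qvec \<Rightarrow> complex" where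
  "cdot v w = (\<Sum>i\<in>UNIV. cnj (v $ i) * w $ i)"

definition adj :: "('n::finite) qop \<Rightarrow> 'n qop" where
  "adj A = (\<chi> i j. cnj (A $ j $ i))"

definition psd :: "('n::finite) qop \<Rightarrow> bool" where
  "psd A \<longleftrightarrow> adj A = A \<and> (\<forall>v. 0 \<le> Re (cdot v (A *v v)))"

definition density_operator :: "('n::finite) qop \<Rightarrow> bool" where
  "density_operator \<rho> \<longleftrightarrow> psd \<rho> \<and> trace \<rho> = 1"

definition ketbra :: "('n::finite) qvec \<Rightarrow> 'n qop" where
  "ketbra \<psi> = (\<chi> i j. \<psi> $ i * cnj (\<psi> $ j))"

definition measurement_setting_family ::
    "'u set \<Rightarrow> ('u \<Rightarrow> 'b set) \<Rightarrow> ('u \<Rightarrow> 'b \<Rightarrow> ('n::finite) qop) \<Rightarrow> bool" where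
  "measurement_setting_family U B P \<longleftrightarrow>
     finite U \<and> (\<forall>u\<in>U. finite (B u)) \<and>
     (\<forall>u\<in>U. \<forall>b\<in>B u. psd (P u b)) \<and>
     (\<forall>u\<in>U. (\<Sum>b\<in>B u. P u b) = mat 1)"

definition admissible_pair ::
    "'u set \<Rightarrow> ('u \<Rightarrow> 'b set) \<Rightarrow> ('u \<Rightarrow> 'b \<Rightarrow> ('n::finite) qop) \<Rightarrow> 'n qop \<Rightarrow>
     'u pmf \<Rightarrow> ('u \<Rightarrow> 'b \<Rightarrow> real) \<Rightarrow> bool" where
  "admissible_pair U B P A q \<alpha> \<longleftrightarrow>
     set_pmf q \<subseteq> U \<and>
     (\<forall>u\<in>U. pmf q u = 0 \<longrightarrow> (\<forall>b\<in>B u. \<alpha> u b = 0)) \<and>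
     (\<Sum>u\<in>U. \<Sum>b\<in>B u. \<alpha> u b *\<^sub>R P u b) = A"

text \<open>For a state \<open>\<rho>\<close> and a setting \<open>u\<close> of a measurement setting family, the numbers \<open>tr(\<rho> P\<^sub>u\<^sub>,\<^sub>b)\<close> are
  real, nonnegative and sum to 1, so \<^const>\<open>embed_pmf\<close> yields the distribution with exactly these
  probabilities.\<close>

definition outcome_pmf ::
    "('u \<Rightarrow> 'b set) \<Rightarrow> ('u \<Rightarrow> 'b \<Rightarrow> ('n::finite) qop) \<Rightarrow> 'n qop \<Rightarrow> 'u \<Rightarrow> 'b pmf" where
  "outcome_pmf B P \<rho> u = embed_pmf (\<lambda>b. if b \<in> B u then Re (trace (\<rho> ** P u b)) else 0)"

definition shot_pmf ::
    "('u \<Rightarrow> 'b set) \<Rightarrow> ('u \<Rightarrow> 'b \<Rightarrow> ('n::finite) qop) \<Rightarrow> 'u pmf \<Rightarrow> 'n qop \<Rightarrow> ('u \<times> 'b) pmf" where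
  "shot_pmf B P q \<rho> = bind_pmf q (\<lambda>u. map_pmf (Pair u) (outcome_pmf B P \<rho> u))"

definition estimator :: "'u pmf \<Rightarrow> ('u \<Rightarrow> 'b \<Rightarrow> real) \<Rightarrow> 'u \<times> 'b \<Rightarrow> real" where
  "estimator q \<alpha> = (\<lambda>(u, b). \<alpha> u b / pmf q u)"

definition second_moment_op ::
    "'u set \<Rightarrow> ('u \<Rightarrow> 'b set) \<Rightarrow> ('u \<Rightarrow> 'b \<Rightarrow> ('n::finite) qop) \<Rightarrow> 'u pmf \<Rightarrow>
     ('u \<Rightarrow> 'b \<Rightarrow> real) \<Rightarrow> 'n qop" where
  "second_moment_op U B P q \<alpha> =
     (\<Sum>u | u \<in> U \<and> pmf q u > 0. \<Sum>b\<in>B u. ((\<alpha> u b)\<^sup>2 / pmf q u) *\<^sub>R P u b)"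

end

theory Submission
  imports Defs
begin

text \<open>The mean and second moment of \<open>X\<close> are finite sums over settings and outcomes, in which the factors
  \<open>q(u)\<close> cancel. The one analytic point is that the numbers \<open>tr(\<rho> P\<^sub>u\<^sub>,\<^sub>b)\<close> really form a probability
  distribution, i.e. that the trace of a product of two positive semidefinite matrices is nonnegative.
  This is proved by Cholesky elimination: subtracting from \<open>B\<close> the rank-one matrix built from its
  \<open>i\<close>-th column removes the \<open>i\<close>-th row and column, keeps \<open>B\<close> positive semidefinite, and
  \<open>tr(A v v\<^sup>*)\<close> is a value of the quadratic form of \<open>A\<close>.\<close>

section \<open>Traces of products\<close>

lemma trace_mult_ketbra: "trace (A ** ketbra v) = cdot v (A *v v)"
  unfolding trace_def matrix_matrix_mult_def cdot_def ketbra_def matrix_vector_mult_def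
  by (simp add: sum_distrib_left mult_ac)

lemma trace_mult_add: "trace (A ** (B + C)) = trace (A ** B) + trace (A ** C)"
  for A B C :: "('n::finite) qop"
  by (simp add: matrix_add_ldistrib trace_add)

lemma trace_mult_scaleR: "trace (A ** (c *\<^sub>R B)) = of_real c * trace (A ** B)"
  for A B :: "('n::finite) qop"
  unfolding trace_def matrix_matrix_mult_def
  by (simp add: scaleR_conv_of_real[where 'a = complex] sum_distrib_left mult_ac)

lemma trace_mult_sum: "trace (A ** (\<Sum>i\<in>S. F i)) = (\<Sum>i\<in>S. trace (A ** F i))"
  for A :: "('n::finite) qop"
proof (induction S rule: infinite_finite_induct)
  case (insert x S)
  then show ?case by (simp add: trace_mult_add)
qed (simp_all add: trace_def matrix_matrix_mult_def)

lemma adj_eq_entries: "adj A = A \<longleftrightarrow> (\<forall>i j. cnj (A $ j $ i) = A $ i $ j)"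
  by (simp add: adj_def vec_eq_iff)

text \<open>Conjugating the entries transposes both Hermitian factors, and exchanging the two
  summation indices undoes this.\<close>

lemma cnj_trace_mult:
  assumes "adj A = A" "adj B = B"
  shows "cnj (trace (A ** B)) = trace (A ** B)"
proof -
  have "cnj (trace (A ** B)) = (\<Sum>i\<in>UNIV. \<Sum>j\<in>UNIV. A $ j $ i * B $ i $ j)"
    using assms by (simp add: trace_def matrix_matrix_mult_def adj_eq_entries)
  also have "\<dots> = trace (A ** B)"
    by (subst sum.swap) (simp add: trace_def matrix_matrix_mult_def)
  finally show ?thesis .
qed

section \<open>Quadratic forms of positive semidefinite matrices\<close>

lemma cdot_diff_right: "cdot u (v - w) = cdot u v - cdot u w"
  and cdot_diff_left: "cdot (u - v) w = cdot u w - cdot v w"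
  by (simp_all add: cdot_def algebra_simps sum_subtractf)

lemma cdot_axis_left: "cdot (axis i t) w = cnj t * w $ i"
proof -
  have "cdot (axis i t) w = (\<Sum>j\<in>UNIV. if j = i then cnj t * w $ j else 0)"
    unfolding cdot_def by (rule sum.cong) (auto simp: axis_def)
  then show ?thesis by simp
qed

lemma mult_axis_nth: "(A *v axis i t) $ j = A $ j $ i * t"
  for A :: "('n::finite) qop"
proof -
  have "(A *v axis i t) $ j = (\<Sum>k\<in>UNIV. if k = i then A $ j $ k * t else 0)"
    unfolding matrix_vector_mult_def by (subst vec_lambda_beta, rule sum.cong) (auto simp: axis_def)
  then show ?thesis by simp
qed

lemma cdot_axis_right_hermitian:
  assumes "adj A = A"
  shows "cdot w (A *v axis i t) = t * cnj ((A *v w) $ i)"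
proof -
  have "cnj (A $ i $ k) = A $ k $ i" for k
    using assms by (simp add: adj_eq_entries)
  then show ?thesis
    unfolding cdot_def mult_axis_nth
    by (simp add: matrix_vector_mult_def sum_distrib_left mult_ac)
qed

text \<open>Both positivity arguments below move a vector along one coordinate axis and watch the
  form. As \<open>A\<close> is Hermitian, the two cross terms are conjugate and merge into twice a
  real part.\<close>

lemma quadratic_form_shift:
  assumes "adj A = A"
  shows "Re (cdot (w - axis i t) (A *v (w - axis i t))) =
    Re (cdot w (A *v w)) - 2 * Re (cnj t * (A *v w) $ i) + (cmod t)\<^sup>2 * Re (A $ i $ i)"
proof -
  have "cnj (A $ i $ i) = A $ i $ i"
    using assms by (simp add: adj_eq_entries)
  have *: "Re (cnj t * (A $ i $ i * t)) = (cmod t)\<^sup>2 * Re (A $ i $ i)"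
    unfolding cmod_power2 by (simp add: power2_eq_square algebra_simps)
  have "cdot (w - axis i t) (A *v (w - axis i t)) =
      cdot w (A *v w) - t * cnj ((A *v w) $ i) - (cnj t * (A *v w) $ i - cnj t * (A $ i $ i * t))"
    by (simp add: matrix_vector_mult_diff_distrib cdot_diff_right cdot_diff_left
        cdot_axis_right_hermitian[OF assms] cdot_axis_left mult_axis_nth
        \<open>cnj (A $ i $ i) = A $ i $ i\<close> algebra_simps)
  then show ?thesis
    using * by simp
qed

lemma psd_diag:
  assumes "psd A"
  shows "A $ i $ i = of_real (Re (A $ i $ i))" and "Re (A $ i $ i) \<ge> 0"
proof -
  have "cnj (A $ i $ i) = A $ i $ i"
    using assms by (simp add: psd_def adj_eq_entries)
  then show "A $ i $ i = of_real (Re (A $ i $ i))"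
    by (metis Reals_cnj_iff of_real_Re)
  have "0 \<le> Re (cdot (axis i 1) (A *v axis i 1))"
    using assms by (simp add: psd_def)
  then show "Re (A $ i $ i) \<ge> 0"
    by (simp add: cdot_axis_left mult_axis_nth)
qed

text \<open>With a zero diagonal entry the quadratic term of the shift disappears, so along the real
  multiples of a fixed shift the form is affine; being bounded below, it has slope zero.\<close>

lemma psd_row_zero:
  assumes "psd A" "A $ i $ i = 0"
  shows "A $ i $ j = 0"
proof (rule ccontr)
  define c where "c = A $ i $ j"
  define x where "x = Re (A $ j $ j)"
  assume "A $ i $ j \<noteq> 0"
  then have pos: "(cmod c)\<^sup>2 > 0" by (simp add: c_def)
  have "x - 2 * k * (cmod c)\<^sup>2 \<ge> 0" for k :: real
  proof -
    \<comment> \<open>Shifting by a real multiple of \<open>c\<close> itself makes the cross term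
      real, namely \<open>k\<close> times the squared modulus of \<open>c\<close>.\<close>
    let ?v = "axis j 1 - axis i (of_real k * c)"
    have "0 \<le> Re (cdot ?v (A *v ?v))"
      using assms(1) by (simp add: psd_def)
    also have "\<dots> = x - 2 * Re (cnj (of_real k * c) * c)"
      using assms by (subst quadratic_form_shift)
        (simp_all add: psd_def cdot_axis_left mult_axis_nth x_def c_def)
    also have "cnj (of_real k * c) * c = of_real (k * (cmod c)\<^sup>2)"
      using complex_norm_square[of c] by (simp add: mult_ac)
    finally show ?thesis by simp
  qed
  \<comment> \<open>This \<open>k\<close> makes the left-hand side equal to -1.\<close>
  from this[of "(x + 1) / (2 * (cmod c)\<^sup>2)"] pos show False
    by (simp add: field_simps)
qed

text \<open>For Hermitian \<open>B\<close> with nonzero pivot this is the Schur complement of the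
  entry (i, i), padded with a zero row and column so that the dimension stays fixed.\<close>

definition eliminate :: "('n \<Rightarrow> bool) \<Rightarrow> ('n::finite) qop \<Rightarrow> 'n qop" where
  "eliminate i B = B - (1 / Re (B $ i $ i)) *\<^sub>R ketbra (column i B)"

lemma eliminate_nth:
  "eliminate i B $ j $ k = B $ j $ k - of_real (1 / Re (B $ i $ i)) * (B $ j $ i * cnj (B $ k $ i))"
  by (simp add: eliminate_def ketbra_def column_def scaleR_conv_of_real[where 'a = complex])

text \<open>Completing the square: the form of \<open>eliminate i B\<close> at \<open>v\<close> is
  the least value of the form of \<open>B\<close> at \<open>v - axis i t\<close> over all complex
  \<open>t\<close>, hence nonnegative.\<close>

lemma psd_eliminate:
  assumes "psd B" "B $ i $ i \<noteq> 0"
  shows "psd (eliminate i B)"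
proof -
  define d where "d = Re (B $ i $ i)"
  have d: "B $ i $ i = of_real d" "d > 0"
    using psd_diag[OF assms(1), of i] assms(2) by (auto simp: d_def less_le)
  have herm: "adj B = B" using assms(1) by (simp add: psd_def)
  then have h: "cnj (B $ j $ k) = B $ k $ j" for j k
    by (simp add: adj_eq_entries)
  have "adj (eliminate i B) = eliminate i B"
    by (simp add: adj_eq_entries eliminate_nth h mult_ac)
  moreover have "0 \<le> Re (cdot v (eliminate i B *v v))" for v
  proof -
    define c where "c = (B *v v) $ i"
    \<comment> \<open>The minimizing shift, at which the linear and quadratic terms together give
      -|c|^2 / d.\<close>
    let ?t = "of_real (1 / d) * c"
    have col: "(ketbra (column i B) *v v) $ j = B $ j $ i * c" for j
      by (simp add: ketbra_def column_def matrix_vector_mult_def c_def sum_distrib_left h mult_ac)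
    have "cdot v (ketbra (column i B) *v v) = cdot v (B *v axis i c)"
      by (simp add: cdot_def col mult_axis_nth)
    also have "\<dots> = c * cnj c"
      by (simp add: cdot_axis_right_hermitian[OF herm] c_def)
    finally have kb: "cdot v (ketbra (column i B) *v v) = of_real ((cmod c)\<^sup>2)"
      using complex_norm_square[of c] by simp
    have lin: "eliminate i B *v v = B *v v - (1 / d) *\<^sub>R (ketbra (column i B) *v v)"
      by (simp add: eliminate_def d_def vec_eq_iff matrix_vector_mult_def
          scaleR_conv_of_real[where 'a = complex] sum_distrib_left sum_subtractf algebra_simps)
    have "cdot v (x *\<^sub>R w) = of_real x * cdot v w" for x w
      by (simp add: cdot_def scaleR_conv_of_real[where 'a = complex] sum_distrib_left mult_ac)
    then have "Re (cdot v (eliminate i B *v v)) = Re (cdot v (B *v v)) - (cmod c)\<^sup>2 / d"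
      by (simp add: lin cdot_diff_right kb)
    moreover have "0 \<le> Re (cdot (v - axis i ?t) (B *v (v - axis i ?t)))"
      using assms(1) by (simp add: psd_def)
    moreover have "Re (cdot (v - axis i ?t) (B *v (v - axis i ?t))) =
        Re (cdot v (B *v v)) - 2 * Re (cnj ?t * c) + (cmod ?t)\<^sup>2 * d"
      by (simp only: quadratic_form_shift[OF herm] c_def d_def)
    moreover have "Re (cnj ?t * c) = (cmod c)\<^sup>2 / d"
      unfolding cmod_power2 by (simp add: power2_eq_square add_divide_distrib)
    moreover have "(cmod ?t)\<^sup>2 * d = (cmod c)\<^sup>2 / d"
      using d(2) by (simp add: norm_mult norm_divide power_divide power2_eq_square)
    ultimately show ?thesis by linarith
  qed
  ultimately show ?thesis by (simp add: psd_def)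
qed

text \<open>Induction on the number of nonzero diagonal entries of \<open>B\<close>. If there are
  none, \<open>psd_row_zero\<close> gives \<open>B = 0\<close>; otherwise one elimination lowers the
  number.\<close>

lemma Re_trace_psd_mult_nonneg:
  assumes "psd A" "psd B"
  shows "0 \<le> Re (trace (A ** B))"
  using assms(2)
proof (induction "card {i. B $ i $ i \<noteq> 0}" arbitrary: B rule: less_induct)
  case less
  show ?case
  proof (cases "\<exists>i. B $ i $ i \<noteq> 0")
    case False
    then have "B = 0"
      using psd_row_zero[OF less.prems] by (simp add: vec_eq_iff)
    then show ?thesis by (simp add: trace_def matrix_matrix_mult_def)
  next
    case True
    then obtain i where i: "B $ i $ i \<noteq> 0" by blast
    have d: "B $ i $ i = of_real (Re (B $ i $ i))" "Re (B $ i $ i) \<ge> 0"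
      using psd_diag[OF less.prems] by blast+
    \<comment> \<open>The pivot is a real number d, so the new entry is d - d * d / d.\<close>
    have "eliminate i B $ i $ i = 0"
      using i by (subst eliminate_nth, subst (1 3 4) d(1)) simp
    \<comment> \<open>No new nonzero diagonal entry appears: a zero at (j, j) forces the entry (j,
      i) to be zero, so nothing is subtracted there.\<close>
    moreover have "eliminate i B $ j $ j = 0" if "B $ j $ j = 0" for j
      using psd_row_zero[OF less.prems that] that by (simp add: eliminate_nth)
    ultimately have "{j. eliminate i B $ j $ j \<noteq> 0} \<subset> {j. B $ j $ j \<noteq> 0}"
      using i by blast
    then have "card {j. eliminate i B $ j $ j \<noteq> 0} < card {j. B $ j $ j \<noteq> 0}"
      by (intro psubset_card_mono) auto
    then have "0 \<le> Re (trace (A ** eliminate i B))"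
      using less.hyps psd_eliminate[OF less.prems i] by blast
    moreover have "0 \<le> Re (trace (A ** ((1 / Re (B $ i $ i)) *\<^sub>R ketbra (column i B))))"
      unfolding trace_mult_scaleR trace_mult_ketbra using assms(1) d(2) by (simp add: psd_def)
    moreover have "B = eliminate i B + (1 / Re (B $ i $ i)) *\<^sub>R ketbra (column i B)"
      by (simp add: eliminate_def)
    ultimately show ?thesis
      by (metis add_nonneg_nonneg plus_complex.sel(1) trace_mult_add)
  qed
qed

text \<open>Leads from the real outcome probabilities back to the complex traces of the
  theorem.\<close>

lemma of_real_Re_trace_psd_mult:
  assumes "psd A" "psd B"
  shows "of_real (Re (trace (A ** B))) = trace (A ** B)"
  using cnj_trace_mult[of A B] assms by (metis Reals_cnj_iff of_real_Re psd_def)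

section \<open>Outcome distribution and moments of the estimator\<close>

context
  fixes U :: "'u set" and B :: "'u \<Rightarrow> 'b set"
    and P :: "'u \<Rightarrow> 'b \<Rightarrow> ('n::finite) qop" and \<rho> :: "'n qop"
  assumes msf: "measurement_setting_family U B P" and dens: "density_operator \<rho>"
begin

text \<open>\<open>embed_pmf\<close> is known to return the given weights once they are nonnegative
  and sum to 1. The first is the trace inequality; the second holds because the effects sum to the
  identity and \<rho> has trace 1.\<close>

lemma pmf_outcome_pmf:
  assumes "u \<in> U"
  shows "pmf (outcome_pmf B P \<rho> u) b = (if b \<in> B u then Re (trace (\<rho> ** P u b)) else 0)"
  unfolding outcome_pmf_def
proof (rule pmf_embed_pmf)
  let ?f = "\<lambda>b. if b \<in> B u then Re (trace (\<rho> ** P u b)) else 0"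
  show nonneg: "0 \<le> ?f b" for b
    using msf dens assms
    by (auto simp: measurement_setting_family_def density_operator_def
        intro!: Re_trace_psd_mult_nonneg)
  have fin: "finite (B u)"
    using msf assms by (simp add: measurement_setting_family_def)
  have "(\<integral>\<^sup>+ b. ennreal (?f b) \<partial>count_space UNIV) = (\<Sum>b\<in>B u. ennreal (?f b))"
    by (rule nn_integral_count_space'[OF fin]) auto
  also have "\<dots> = ennreal (\<Sum>b\<in>B u. ?f b)"
    using nonneg by (rule sum_ennreal)
  also have "(\<Sum>b\<in>B u. ?f b) = Re (trace (\<rho> ** (\<Sum>b\<in>B u. P u b)))"
    by (simp add: trace_mult_sum)
  also have "\<dots> = 1"
    using msf dens assms by (simp add: measurement_setting_family_def density_operator_def)
  finally show "(\<integral>\<^sup>+ b. ennreal (?f b) \<partial>count_space UNIV) = 1" by simp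
qed

lemma set_outcome_pmf: "u \<in> U \<Longrightarrow> set_pmf (outcome_pmf B P \<rho> u) \<subseteq> B u"
  by (auto simp: set_pmf_iff pmf_outcome_pmf split: if_splits)

lemma finite_settings: "finite U" and finite_outcomes: "u \<in> U \<Longrightarrow> finite (B u)"
  using msf by (auto simp: measurement_setting_family_def)

lemma finite_set_shot_pmf:
  assumes "set_pmf q \<subseteq> U"
  shows "finite (set_pmf (shot_pmf B P q \<rho>))"
proof (rule finite_subset)
  show "set_pmf (shot_pmf B P q \<rho>) \<subseteq> Sigma U B"
    using assms set_outcome_pmf by (auto simp: shot_pmf_def)
qed (simp add: finite_settings finite_outcomes)

lemma expectation_shot_pmf:
  fixes f :: "'u \<times> 'b \<Rightarrow> real"
  assumes "set_pmf q \<subseteq> U"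
  shows "measure_pmf.expectation (shot_pmf B P q \<rho>) f =
    (\<Sum>u\<in>U. pmf q u * (\<Sum>b\<in>B u. Re (trace (\<rho> ** P u b)) * f (u, b)))"
proof -
  have "measure_pmf.expectation (shot_pmf B P q \<rho>) f =
      (\<Sum>u\<in>U. pmf q u *\<^sub>R measure_pmf.expectation (map_pmf (Pair u) (outcome_pmf B P \<rho> u)) f)"
    unfolding shot_pmf_def
    using assms finite_settings finite_subset[OF set_outcome_pmf finite_outcomes]
    by (intro pmf_expectation_bind) auto
  also have "\<dots> = (\<Sum>u\<in>U. pmf q u * (\<Sum>b\<in>B u. Re (trace (\<rho> ** P u b)) * f (u, b)))"
  proof (rule sum.cong[OF refl])
    fix u assume u: "u \<in> U"
    have "measure_pmf.expectation (outcome_pmf B P \<rho> u) (\<lambda>b. f (u, b)) =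
        (\<Sum>b\<in>B u. pmf (outcome_pmf B P \<rho> u) b *\<^sub>R f (u, b))"
      using set_outcome_pmf[OF u] by (intro integral_measure_pmf finite_outcomes u) auto
    then show "pmf q u *\<^sub>R measure_pmf.expectation (map_pmf (Pair u) (outcome_pmf B P \<rho> u)) f =
        pmf q u * (\<Sum>b\<in>B u. Re (trace (\<rho> ** P u b)) * f (u, b))"
      by (simp add: pmf_outcome_pmf[OF u])
  qed
  finally show ?thesis .
qed

lemma of_real_Re_trace_effect:
  "u \<in> U \<Longrightarrow> b \<in> B u \<Longrightarrow> of_real (Re (trace (\<rho> ** P u b))) = trace (\<rho> ** P u b)"
  using msf dens
  by (intro of_real_Re_trace_psd_mult) (auto simp: measurement_setting_family_def density_operator_def)

lemma expectation_estimator: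
  assumes "admissible_pair U B P A q \<alpha>"
  shows "of_real (measure_pmf.expectation (shot_pmf B P q \<rho>) (estimator q \<alpha>)) = trace (\<rho> ** A)"
proof -
  have sub: "set_pmf q \<subseteq> U"
    and zero: "\<And>u b. u \<in> U \<Longrightarrow> b \<in> B u \<Longrightarrow> pmf q u = 0 \<Longrightarrow> \<alpha> u b = 0"
    and A: "A = (\<Sum>u\<in>U. \<Sum>b\<in>B u. \<alpha> u b *\<^sub>R P u b)"
    using assms by (auto simp: admissible_pair_def)
  have "measure_pmf.expectation (shot_pmf B P q \<rho>) (estimator q \<alpha>) =
      (\<Sum>u\<in>U. \<Sum>b\<in>B u. \<alpha> u b * Re (trace (\<rho> ** P u b)))"
    \<comment> \<open>The factor q(u) cancels when it is nonzero. Otherwise the left term is 0, and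
      so is the right one, since \<alpha> vanishes on settings of probability zero.\<close>
    unfolding expectation_shot_pmf[OF sub] estimator_def
    by (auto simp: sum_distrib_left zero intro!: sum.cong)
  then show ?thesis
    by (simp add: A trace_mult_sum trace_mult_scaleR of_real_Re_trace_effect)
qed

lemma second_moment_estimator:
  assumes "set_pmf q \<subseteq> U"
  shows "of_real (measure_pmf.expectation (shot_pmf B P q \<rho>) (\<lambda>x. (estimator q \<alpha> x)\<^sup>2)) =
    trace (\<rho> ** second_moment_op U B P q \<alpha>)"
proof -
  have "measure_pmf.expectation (shot_pmf B P q \<rho>) (\<lambda>x. (estimator q \<alpha> x)\<^sup>2) =
      (\<Sum>u\<in>U. \<Sum>b\<in>B u. (\<alpha> u b)\<^sup>2 / pmf q u * Re (trace (\<rho> ** P u b)))"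
    \<comment> \<open>One of two factors q(u) cancels. At q(u) = 0 both terms are 0, the right one
      because division by zero yields 0; the next step drops these settings.\<close>
    unfolding expectation_shot_pmf[OF assms] estimator_def
    by (auto simp: sum_distrib_left power2_eq_square intro!: sum.cong)
  also have "\<dots> = (\<Sum>u | u \<in> U \<and> pmf q u > 0. \<Sum>b\<in>B u. (\<alpha> u b)\<^sup>2 / pmf q u * Re (trace (\<rho> ** P u b)))"
    using finite_settings by (intro sum.mono_neutral_right) (auto simp: less_le)
  finally show ?thesis
    by (simp add: second_moment_op_def trace_mult_sum trace_mult_scaleR of_real_Re_trace_effect)
qed

end

theorem mainTheorem2:
  fixes U :: "'u set" and B :: "'u \<Rightarrow> 'b set"
    and P :: "'u \<Rightarrow> 'b \<Rightarrow> ('n::finite) qop"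
    and \<psi> :: "'n qvec"
    and q :: "'u pmf" and \<alpha> :: "'u \<Rightarrow> 'b \<Rightarrow> real"
    and \<rho> :: "'n qop"
  assumes "measurement_setting_family U B P"
    and "norm \<psi> = 1"
    and "admissible_pair U B P (ketbra \<psi>) q \<alpha>"
    and "density_operator \<rho>"
  shows "complex_of_real (measure_pmf.variance (shot_pmf B P q \<rho>) (estimator q \<alpha>)) =
    trace (\<rho> ** second_moment_op U B P q \<alpha>) - (trace (\<rho> ** ketbra \<psi>))\<^sup>2"
proof -
  let ?M = "shot_pmf B P q \<rho>" and ?X = "estimator q \<alpha>"
  have sub: "set_pmf q \<subseteq> U"
    using assms(3) by (simp add: admissible_pair_def)
  \<comment> \<open>Finite support supplies the integrability of X and its square that
    \<open>variance_eq\<close> requires.\<close>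
  have "integrable (measure_pmf ?M) f" for f :: "'u \<times> 'b \<Rightarrow> real"
    by (rule integrable_measure_pmf_finite[OF finite_set_shot_pmf[OF assms(1,4) sub]])
  then have "measure_pmf.variance ?M ?X =
      measure_pmf.expectation ?M (\<lambda>x. (?X x)\<^sup>2) - (measure_pmf.expectation ?M ?X)\<^sup>2"
    by (intro measure_pmf.variance_eq)
  then show ?thesis
    by (simp only: of_real_diff of_real_power expectation_estimator[OF assms(1,4,3)]
        second_moment_estimator[OF assms(1,4) sub])
qed

end
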